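(* Let $d\geq5$ and let $\lambda_k=\mu_k!$, where $(\mu_k)_{k\ge1}$ is a strictly increasing sequence of positive integers. Suppose that, for some $C_0<\infty$, $$\#\{x\in\mathbb{Z}^d:A_\star f(x)>\alpha\}\leq C_0\sum_{x\in\mathbb{Z}^d}\frac{|f(x)|}{\alpha}\,\mathcal{L}\left(\frac{|f(x)|}{\alpha}\right)$$ for every $\alpha>0$ and every finitely supported $f:\mathbb{Z}^d\to\mathbb{C}$. Then $$\mathcal{N}_\mu(N)\leq C_{d,C_0}(1+\log N)^2\qquad\text{for all } N\geq2,$$ where $C_{d,C_0}$ is a finite constant depending only on $d$ and $C_0$.
   Context: For $\lambda\in\mathbb{N}$ (positive integers), $s_\lambda=\#\{n\in\mathbb{Z}^d:|n|^2=\lambda\}$ (where $|\cdot|$ is the Euclidean norm; $s_\lambda>0$ since $d\ge5$) and $$A_\lambda f(x)=\frac{1}{s_\lambda}\sum_{n\in\mathbb{Z}^d,\,|n|^2=\lambda}f(x-n).$$ The maximal operator is $A_\star f(x)=\sup_{k\ge1}|A_{\lambda_k}f(x)|$. For real $N\geq2$, $\mathcal{N}_\mu(N)=\#\{k\geq1:\mu_k\leq N\}$. Logarithms are natural; $\log^+t=\max\{0,\log t\}$ for $t>0$; $\mathcal{L}(t)=1+\log^+t$ for $t>0$ and $\mathcal{L}(0)=1$. *)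

theory Defs
  imports "HOL-Analysis.Analysis"
begin

text \<open>The inclusion of \<open>\<int>\<^sup>d\<close> into \<open>\<real>\<^sup>d\<close>, which supplies the Euclidean norm on lattice points.\<close>

definition real_vec :: "int ^ 'd \<Rightarrow> real ^ 'd" where
  "real_vec n = (\<chi> i. real_of_int (n $ i))"

definition lattice_sphere :: "nat \<Rightarrow> (int ^ 'd::finite) set" where
  "lattice_sphere l = {n. (norm (real_vec n))\<^sup>2 = real l}"

lemma norm_real_vec_sq: "(norm (real_vec n))\<^sup>2 = real_of_int (\<Sum>i\<in>UNIV. (n $ i)\<^sup>2)"
  by (simp add: real_vec_def norm_vec_def L2_set_def sum_nonneg)

lemma mem_lattice_sphere_iff:
  "n \<in> lattice_sphere l \<longleftrightarrow> (\<Sum>i\<in>UNIV. (n $ i)\<^sup>2) = int l"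
proof -
  have "n \<in> lattice_sphere l \<longleftrightarrow> real_of_int (\<Sum>i\<in>UNIV. (n $ i)\<^sup>2) = real_of_int (int l)"
    unfolding lattice_sphere_def mem_Collect_eq norm_real_vec_sq by simp
  then show ?thesis
    by (simp only: of_int_eq_iff)
qed

lemma finite_lattice_sphere: "finite (lattice_sphere l :: (int ^ 'd::finite) set)"
proof (rule finite_subset)
  let ?F = "{g. \<forall>i::'d. g i \<in> {- int l..int l}}"
  show "lattice_sphere l \<subseteq> vec_lambda ` ?F"
  proof
    fix n :: "int ^ 'd"
    assume "n \<in> lattice_sphere l"
    then have s: "(\<Sum>i\<in>UNIV. (n $ i)\<^sup>2) = int l"
      by (simp only: mem_lattice_sphere_iff)
    have "n $ i \<in> {- int l..int l}" for i
    proof -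
      have "(n $ i)\<^sup>2 \<le> int l"
        unfolding s[symmetric] by (rule member_le_sum) auto
      moreover have "\<bar>n $ i\<bar> \<le> (n $ i)\<^sup>2"
      proof (cases "n $ i = 0")
        case False
        then have "\<bar>n $ i\<bar> * 1 \<le> \<bar>n $ i\<bar> * \<bar>n $ i\<bar>"
          by (intro mult_left_mono) auto
        then show ?thesis
          by (simp add: power2_eq_square)
      qed simp
      ultimately show ?thesis
        by auto
    qed
    then show "n \<in> vec_lambda ` ?F"
      by (intro image_eqI[of _ _ "vec_nth n"]) auto
  qed
  have "finite (PiE UNIV (\<lambda>_::'d. {- int l..int l}))"
    by (intro finite_PiE) auto
  then show "finite (vec_lambda ` ?F)"
    by (simp add: PiE_UNIV_domain Pi_def)
qed

definition spherical_avg :: "nat \<Rightarrow> (int ^ 'd::finite \<Rightarrow> complex) \<Rightarrow> int ^ 'd \<Rightarrow> complex" where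
  "spherical_avg l f x =
     1 / of_nat (card (lattice_sphere l :: (int ^ 'd) set)) * (\<Sum>n\<in>lattice_sphere l. f (x - n))"

text \<open>Sequences are indexed by \<open>k \<ge> 1\<close>; the value at \<open>0\<close> is never used. The supremum is
  taken in the extended reals, so it is meaningful for every \<open>f\<close>.\<close>

definition maximal_op :: "(nat \<Rightarrow> nat) \<Rightarrow> (int ^ 'd::finite \<Rightarrow> complex) \<Rightarrow> int ^ 'd \<Rightarrow> ereal" where
  "maximal_op lam f x = (SUP k\<in>{1..}. ereal (cmod (spherical_avg (lam k) f x)))"

definition log_plus :: "real \<Rightarrow> real" where
  "log_plus t = max 0 (ln t)"

definition LL :: "real \<Rightarrow> real" where
  "LL t = (if t > 0 then 1 + log_plus t else 1)"

definition counting :: "(nat \<Rightarrow> nat) \<Rightarrow> real \<Rightarrow> nat" where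
  "counting \<mu> N = card {k. k \<ge> 1 \<and> real (\<mu> k) \<le> N}"

text \<open>Since \<open>card\<close> is \<open>0\<close> on infinite sets, the bound of a cardinality by a real number
  includes finiteness of the level set.\<close>

definition weak_LlogL_bound :: "'d::finite itself \<Rightarrow> (nat \<Rightarrow> nat) \<Rightarrow> real \<Rightarrow> bool" where
  "weak_LlogL_bound _ lam C0 \<longleftrightarrow>
     (\<forall>\<alpha>>0. \<forall>f :: int ^ 'd \<Rightarrow> complex. finite {x. f x \<noteq> 0} \<longrightarrow>
        finite {x. maximal_op lam f x > ereal \<alpha>} \<and>
        real (card {x. maximal_op lam f x > ereal \<alpha>})
          \<le> C0 * (\<Sum>\<^sub>\<infinity>x. cmod (f x) / \<alpha> * LL (cmod (f x) / \<alpha>)))"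

end

theory Submission
  imports Defs "HOL-Computational_Algebra.Primes"
begin

text \<open>Let \<open>n = \<lfloor>N\<rfloor>\<close> and choose a modulus \<open>q\<close>, polynomial in \<open>n\<close>, such that the
  factorials of \<open>1, \<dots>, n\<close> are distinct modulo \<open>q\<close>; it exists because the product of all their
  differences is smaller than every common multiple of all integers up to \<open>2 (n\<^sup>4 + 1)\<close>.
  Testing the hypothesis on a truncated indicator function of \<open>q \<int>\<^sup>d\<close> at height \<open>2\<^sup>-\<^sup>j\<close> bounds
  by \<open>O(j 2\<^sup>j)\<close> the number of residue classes \<open>t\<close> modulo \<open>q\<close> such that one of the spheres
  under consideration has more than the proportion \<open>2\<^sup>-\<^sup>j\<close> of its points in \<open>t\<close>. Since
  \<open>|t|\<^sup>2\<close> determines the squared radius modulo \<open>q\<close>, different spheres meet different classes. Summing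
  over \<open>j = O(log q)\<close> and using that the proportions of each sphere add up to \<open>1\<close>, one finds
  at most \<open>O((log q)\<^sup>2)\<close> spheres. The only other input is that no sphere is empty, which
  is Lagrange's four-square theorem.\<close>

subsection \<open>Sums of four squares\<close>

definition sum4sq :: "int \<Rightarrow> bool" where
  "sum4sq n \<longleftrightarrow> (\<exists>a b c d. n = a\<^sup>2 + b\<^sup>2 + c\<^sup>2 + d\<^sup>2)"

lemma sum4sqI: "n = a\<^sup>2 + b\<^sup>2 + c\<^sup>2 + d\<^sup>2 \<Longrightarrow> sum4sq n"
  unfolding sum4sq_def by blast

lemma euler_four_square:
  fixes a b c d x y z w :: int
  shows "(a\<^sup>2 + b\<^sup>2 + c\<^sup>2 + d\<^sup>2) * (x\<^sup>2 + y\<^sup>2 + z\<^sup>2 + w\<^sup>2)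
    = (a*x + b*y + c*z + d*w)\<^sup>2 + (a*y - b*x + c*w - d*z)\<^sup>2
      + (a*z - c*x + d*y - b*w)\<^sup>2 + (a*w - d*x + b*z - c*y)\<^sup>2"
  by algebra

lemma sum4sq_mult: "sum4sq m \<Longrightarrow> sum4sq n \<Longrightarrow> sum4sq (m * n)"
  unfolding sum4sq_def using euler_four_square by meson

text \<open>Uses \<open>((a + b)/2)^2 + ((a - b)/2)^2 = (a^2 + b^2)/2\<close> for each pair.\<close>

lemma sum4sq_half_aux:
  fixes a b c d n :: int
  assumes "2 * n = a\<^sup>2 + b\<^sup>2 + c\<^sup>2 + d\<^sup>2" "even (a + b)" "even (c + d)"
  shows "sum4sq n"
proof -
  obtain u v where u: "a + b = 2 * u" and v: "c + d = 2 * v"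
    using assms by (meson evenE)
  have "b = 2 * u - a" "d = 2 * v - c" using u v by auto
  then have "2 * n = 2 * (u\<^sup>2 + (u - a)\<^sup>2 + v\<^sup>2 + (v - c)\<^sup>2)"
    unfolding assms(1) by algebra
  then have "n = u\<^sup>2 + (u - a)\<^sup>2 + v\<^sup>2 + (v - c)\<^sup>2"
    by (metis mult_cancel_left zero_neq_numeral)
  then show ?thesis by (rule sum4sqI)
qed

lemma sum4sq_half:
  assumes "sum4sq (2 * n)" shows "sum4sq n"
proof -
  obtain a b c d where e: "2 * n = a\<^sup>2 + b\<^sup>2 + c\<^sup>2 + d\<^sup>2"
    using assms unfolding sum4sq_def by blast
  have "even (a\<^sup>2 + b\<^sup>2 + c\<^sup>2 + d\<^sup>2)" unfolding e[symmetric] by simp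
  \<comment> \<open>An even number of the four terms is odd, so they split into two pairs of equal
    parity.\<close>
  then consider "even (a + b)" "even (c + d)" | "even (a + c)" "even (b + d)"
    | "even (a + d)" "even (b + c)"
    by auto
  then show ?thesis
    using sum4sq_half_aux[of n a b c d] sum4sq_half_aux[of n a c b d]
      sum4sq_half_aux[of n a d b c] e
    by cases (auto simp: algebra_simps)
qed

text \<open>For odd \<open>m\<close> no residue equals \<open>m/2\<close>; the resulting strict
  bound gives \<open>r < m\<close> in the descent.\<close>

lemma centered_residue:
  fixes a m :: int
  assumes "odd m" "m > 0"
  obtains x where "m dvd x - a" "2 * \<bar>x\<bar> < m"
proof (cases "2 * (a mod m) < m")
  case True
  then show ?thesis using assms by (intro that[of "a mod m"]) (auto simp: mod_eq_dvd_iff[symmetric])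
next
  case False
  have "a mod m < m" using assms by simp
  moreover have "2 * (a mod m) \<noteq> m" using assms by (metis dvd_triv_left)
  moreover have "m dvd a mod m - m - a"
    by (metis dvd_diff dvd_refl mod_eq_dvd_iff mod_mod_trivial diff_diff_eq diff_diff_eq2 add.commute)
  ultimately show ?thesis using False by (intro that[of "a mod m - m"]) auto
qed

text \<open>Lagrange's descent. An even multiplier is halved. For odd \<open>m\<close>, centered
  residues of the four roots have a sum of squares \<open>m * r\<close> with \<open>r < m\<close>;
  in Euler's product of the two sums every root is divisible by \<open>m\<close>, and dividing by
  \<open>m^2\<close> represents \<open>r * p\<close>.\<close>

lemma four_square_descent:
  fixes m p :: int
  assumes p: "prime p" and m: "1 < m" "m < p" and s: "sum4sq (m * p)"
  shows "\<exists>r. 0 < r \<and> r < m \<and> sum4sq (r * p)"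
proof (cases "even m")
  case True
  then obtain r where r: "m = 2 * r" by blast
  have "sum4sq (r * p)" using sum4sq_half[of "r * p"] s by (simp add: r mult.assoc)
  then show ?thesis using m r by (intro exI[of _ r]) auto
next
  case False
  obtain a b c d where e: "m * p = a\<^sup>2 + b\<^sup>2 + c\<^sup>2 + d\<^sup>2"
    using s unfolding sum4sq_def by blast
  have m0: "m > 0" using m by simp
  obtain x where x: "m dvd x - a" "2 * \<bar>x\<bar> < m" using centered_residue[OF False m0] by blast
  obtain y where y: "m dvd y - b" "2 * \<bar>y\<bar> < m" using centered_residue[OF False m0] by blast
  obtain z where z: "m dvd z - c" "2 * \<bar>z\<bar> < m" using centered_residue[OF False m0] by blast
  obtain w where w: "m dvd w - d" "2 * \<bar>w\<bar> < m" using centered_residue[OF False m0] by blast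
  obtain x' where x': "x = a + m * x'" using x(1) by (metis dvdE diff_eq_eq add.commute)
  obtain y' where y': "y = b + m * y'" using y(1) by (metis dvdE diff_eq_eq add.commute)
  obtain z' where z': "z = c + m * z'" using z(1) by (metis dvdE diff_eq_eq add.commute)
  obtain w' where w': "w = d + m * w'" using w(1) by (metis dvdE diff_eq_eq add.commute)
  define r where "r = p + 2 * (a * x' + b * y' + c * z' + d * w') + m * (x'\<^sup>2 + y'\<^sup>2 + z'\<^sup>2 + w'\<^sup>2)"
  have mr: "x\<^sup>2 + y\<^sup>2 + z\<^sup>2 + w\<^sup>2 = m * r"
    using e unfolding r_def x' y' z' w' by algebra
  have sq: "4 * u\<^sup>2 < m\<^sup>2" if "2 * \<bar>u\<bar> < m" for u :: int
  proof -
    have "(2 * \<bar>u\<bar>)\<^sup>2 < m\<^sup>2" using that by (intro power_strict_mono) auto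
    then show ?thesis by (simp add: power_mult_distrib)
  qed
  have "m * r < m * m"
    using sq[OF x(2)] sq[OF y(2)] sq[OF z(2)] sq[OF w(2)] mr unfolding power2_eq_square[of m] by linarith
  then have rm: "r < m" using m0 by simp
  have "0 \<le> m * r" unfolding mr[symmetric] by simp
  then have r0: "0 \<le> r" using m0 by (simp add: zero_le_mult_iff)
  \<comment> \<open>If all residues vanish, \<open>m\<close> divides \<open>a\<close>,
    \<open>b\<close>, \<open>c\<close>, \<open>d\<close>, so \<open>m^2\<close> divides
    \<open>m * p\<close>, against \<open>p\<close> prime and \<open>1 < m < p\<close>.\<close>
  have "r \<noteq> 0"
  proof
    assume "r = 0"
    then have "x\<^sup>2 + y\<^sup>2 + z\<^sup>2 + w\<^sup>2 = 0" using mr by simp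
    then have "x\<^sup>2 = 0 \<and> y\<^sup>2 = 0 \<and> z\<^sup>2 = 0 \<and> w\<^sup>2 = 0"
      using zero_le_power2[of x] zero_le_power2[of y] zero_le_power2[of z] zero_le_power2[of w]
      by linarith
    then have "a = - m * x'" "b = - m * y'" "c = - m * z'" "d = - m * w'"
      using x' y' z' w' by auto
    then have "m * p = m * (m * (x'\<^sup>2 + y'\<^sup>2 + z'\<^sup>2 + w'\<^sup>2))"
      unfolding e by algebra
    then have "m dvd p" using m0 by auto
    then have "m = 1 \<or> m = p" using p m unfolding prime_int_iff by (meson less_imp_le m0)
    then show False using m by simp
  qed
  then have r1: "0 < r" using r0 by simp
  define A where "A = p + a*x' + b*y' + c*z' + d*w'"
  define B where "B = a*y' - b*x' + c*w' - d*z'"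
  define C where "C = a*z' - c*x' + d*y' - b*w'"
  define D where "D = a*w' - d*x' + b*z' - c*y'"
  have "(m*m) * (r * p) = (a\<^sup>2 + b\<^sup>2 + c\<^sup>2 + d\<^sup>2) * (x\<^sup>2 + y\<^sup>2 + z\<^sup>2 + w\<^sup>2)"
    unfolding mr e[symmetric] by simp
  also have "\<dots> = (a*x + b*y + c*z + d*w)\<^sup>2 + (a*y - b*x + c*w - d*z)\<^sup>2
      + (a*z - c*x + d*y - b*w)\<^sup>2 + (a*w - d*x + b*z - c*y)\<^sup>2"
    by (rule euler_four_square)
  also have "a*x + b*y + c*z + d*w = m * A"
    using e unfolding A_def x' y' z' w' by algebra
  also have "a*y - b*x + c*w - d*z = m * B"
    unfolding B_def x' y' z' w' by algebra
  also have "a*z - c*x + d*y - b*w = m * C"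
    unfolding C_def x' y' z' w' by algebra
  also have "a*w - d*x + b*z - c*y = m * D"
    unfolding D_def x' y' z' w' by algebra
  also have "(m * A)\<^sup>2 + (m * B)\<^sup>2 + (m * C)\<^sup>2 + (m * D)\<^sup>2 = (m*m) * (A\<^sup>2 + B\<^sup>2 + C\<^sup>2 + D\<^sup>2)"
    by algebra
  finally have "r * p = A\<^sup>2 + B\<^sup>2 + C\<^sup>2 + D\<^sup>2" using m0 by simp
  then show ?thesis using r1 rm sum4sqI by blast
qed

text \<open>Pigeonhole: with \<open>p = 2 h + 1\<close>, the values \<open>a^2\<close> and
  \<open>-1 - b^2\<close> for \<open>a\<close>, \<open>b\<close> in \<open>{0..h}\<close> each fill
  \<open>h + 1\<close> classes modulo \<open>p\<close>, and \<open>2 h + 2 > p\<close>.\<close>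

lemma prime_dvd_sum_two_squares_plus_one:
  fixes p :: int
  assumes p: "prime p" and odd: "odd p"
  obtains a b where "p dvd a\<^sup>2 + b\<^sup>2 + 1" "2 * \<bar>a\<bar> < p" "2 * \<bar>b\<bar> < p"
proof -
  obtain h where h: "p = 2 * h + 1" using odd by (elim oddE)
  have h0: "h > 0" using prime_gt_1_int[OF p] h by simp
  let ?I = "{0..h}"
  define F where "F = (\<lambda>a::int. a\<^sup>2 mod p)"
  define G where "G = (\<lambda>b::int. (- 1 - b\<^sup>2) mod p)"
  have key: "a = b" if "a \<in> ?I" "b \<in> ?I" "p dvd a\<^sup>2 - b\<^sup>2" for a b
  proof -
    have "a\<^sup>2 - b\<^sup>2 = (a - b) * (a + b)" by algebra
    then have "p dvd a - b \<or> p dvd a + b" using that(3) p by (simp add: prime_dvd_mult_iff)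
    then show ?thesis
    proof
      assume "p dvd a - b"
      then show ?thesis using that h zdvd_not_zless[of "a - b" p] dvd_imp_le_int[of "a - b" p] by force
    next
      assume "p dvd a + b"
      then have "a + b = 0" using that h dvd_imp_le_int[of "a + b" p] by force
      then show ?thesis using that by auto
    qed
  qed
  have "inj_on F ?I" using key unfolding F_def inj_on_def by (simp add: mod_eq_dvd_iff)
  moreover have "inj_on G ?I"
    unfolding inj_on_def G_def
  proof (intro ballI impI)
    fix a b assume ab: "a \<in> ?I" "b \<in> ?I" "(- 1 - a\<^sup>2) mod p = (- 1 - b\<^sup>2) mod p"
    then have "p dvd b\<^sup>2 - a\<^sup>2" by (simp add: mod_eq_dvd_iff)
    then show "a = b" using key[of b a] ab by simp
  qed
  ultimately have cards: "card (F ` ?I) = nat (h + 1)" "card (G ` ?I) = nat (h + 1)"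
    by (simp_all add: card_image)
  have "F ` ?I \<inter> G ` ?I \<noteq> {}"
  proof
    assume "F ` ?I \<inter> G ` ?I = {}"
    then have "card (F ` ?I \<union> G ` ?I) = 2 * nat (h + 1)" using cards by (simp add: card_Un_disjoint)
    moreover have "F ` ?I \<union> G ` ?I \<subseteq> {0..<p}" using prime_gt_0_int[OF p] unfolding F_def G_def by auto
    then have "card (F ` ?I \<union> G ` ?I) \<le> card {0..<p}" by (intro card_mono) auto
    ultimately show False using h h0 by simp
  qed
  then obtain a b where ab: "a \<in> ?I" "b \<in> ?I" "F a = G b" by blast
  then have "p dvd a\<^sup>2 - (- 1 - b\<^sup>2)" unfolding F_def G_def by (simp add: mod_eq_dvd_iff)
  then have "p dvd a\<^sup>2 + b\<^sup>2 + 1" by (simp add: algebra_simps)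
  then show ?thesis using ab h by (intro that[of a b]) auto
qed

text \<open>For odd \<open>p\<close>, a sum \<open>a^2 + b^2 + 1^2 + 0^2\<close> with small
  \<open>a\<close>, \<open>b\<close> equals \<open>m * p\<close> with \<open>m < p\<close>; descent
  lowers the multiplier to 1.\<close>

lemma sum4sq_prime:
  fixes p :: int
  assumes p: "prime p"
  shows "sum4sq p"
proof (cases "even p")
  case True
  then have "p = 2" using p unfolding prime_int_iff
    by (metis numeral_eq_one_iff semiring_norm(85) zero_le_numeral)
  then show ?thesis by (intro sum4sqI[of _ 1 1 0 0]) simp
next
  case False
  obtain a b where ab: "p dvd a\<^sup>2 + b\<^sup>2 + 1" "2 * \<bar>a\<bar> < p" "2 * \<bar>b\<bar> < p"
    using prime_dvd_sum_two_squares_plus_one[OF p False] by blast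
  obtain m where m: "a\<^sup>2 + b\<^sup>2 + 1 = m * p" using ab(1) by (metis dvdE mult.commute)
  have p1: "p > 1" using p by (simp add: prime_gt_1_int)
  have sq: "4 * u\<^sup>2 < p\<^sup>2" if "2 * \<bar>u\<bar> < p" for u :: int
  proof -
    have "(2 * \<bar>u\<bar>)\<^sup>2 < p\<^sup>2" using that by (intro power_strict_mono) auto
    then show ?thesis by (simp add: power_mult_distrib)
  qed
  have "p * 2 \<le> p * p" using p1 by (intro mult_left_mono) auto
  then have "m * p < p * p" using sq[OF ab(2)] sq[OF ab(3)] m p1 unfolding power2_eq_square[of p] by linarith
  then have mp: "m < p" using p1 by simp
  have "0 < m * p" unfolding m[symmetric] using zero_le_power2[of a] zero_le_power2[of b] by linarith
  then have m0: "0 < m" using p1 by (simp add: zero_less_mult_iff)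
  have s: "sum4sq (m * p)" using m by (intro sum4sqI[of _ a b 1 0]) simp
  have "sum4sq (m * p) \<Longrightarrow> 0 < m \<Longrightarrow> m < p \<Longrightarrow> sum4sq p" for m
  proof (induction "nat m" arbitrary: m rule: less_induct)
    case less
    show ?case
    proof (cases "m = 1")
      case True then show ?thesis using less by simp
    next
      case False
      then obtain r where "0 < r" "r < m" "sum4sq (r * p)"
        using four_square_descent[OF p _ less.prems(3,1)] less.prems(2) by auto
      then show ?thesis using less by (intro less.hyps[of r]) auto
    qed
  qed
  then show ?thesis using s m0 mp by blast
qed

theorem lagrange_four_squares: "sum4sq (int n)"
proof (induction n rule: less_induct)
  case (less n)
  show ?case
  proof (cases "n \<le> 1")
    case True
    then consider "n = 0" | "n = 1" by linarith
    then show ?thesis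
      by cases (simp_all add: sum4sqI[of 0 0 0 0 0] sum4sqI[of 1 1 0 0 0])
  next
    case False
    then obtain p where p: "prime p" "p dvd n" using prime_factor_nat[of n] by auto
    then obtain m where m: "n = p * m" by blast
    have "m < n" using m p False prime_gt_1_nat[of p] by (cases "m = 0") auto
    then have "sum4sq (int m)" by (rule less.IH)
    moreover have "sum4sq (int p)" using p by (intro sum4sq_prime) simp
    ultimately show ?thesis unfolding m of_nat_mult by (intro sum4sq_mult)
  qed
qed

text \<open>Four coordinates carry a four-square representation of \<open>l\<close>; the others
  vanish.\<close>

lemma lattice_sphere_nonempty:
  assumes "CARD('d::finite) \<ge> 4"
  shows "lattice_sphere l \<noteq> ({} :: (int ^ 'd) set)"
proof -
  obtain U :: "'d set" where "card U = 4"
    using obtain_subset_with_card_n[OF assms] by metis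
  then obtain i j k m :: 'd where "distinct [i, j, k, m]"
    by (auto simp: eval_nat_numeral card_Suc_eq)
  then have ne: "i \<noteq> j" "i \<noteq> k" "i \<noteq> m" "j \<noteq> k" "j \<noteq> m" "k \<noteq> m" by auto
  obtain a b c d where l: "int l = a\<^sup>2 + b\<^sup>2 + c\<^sup>2 + d\<^sup>2"
    using lagrange_four_squares[of l] unfolding sum4sq_def by blast
  define n :: "int ^ 'd" where
    "n = (\<chi> x. if x = i then a else if x = j then b else if x = k then c else if x = m then d else 0)"
  have "(\<Sum>x\<in>UNIV. (n $ x)\<^sup>2) = (\<Sum>x\<in>{i, j, k, m}. (n $ x)\<^sup>2)"
    by (intro sum.mono_neutral_right) (auto simp: n_def)
  also have "\<dots> = int l" unfolding l n_def using ne by simp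
  finally have "n \<in> lattice_sphere l" unfolding mem_lattice_sphere_iff .
  then show ?thesis by blast
qed

subsection \<open>A modulus that separates factorials\<close>

text \<open>The numbers \<open>1 / (m (m + i choose m))\<close> form Leibniz's harmonic triangle: the entry at
  \<open>(m, i + 1)\<close> is the difference of those at \<open>(m, i)\<close> and \<open>(m + 1, i)\<close>, so each entry is an
  integer combination of \<open>1, 1/2, \<dots>, 1/(m + i)\<close>.\<close>

lemma leibniz_triangle_integral:
  assumes "\<And>q. 1 \<le> q \<Longrightarrow> q \<le> m + i \<Longrightarrow> q dvd D" and "1 \<le> m"
  shows "real D / (real m * real (m + i choose m)) \<in> \<int>"
  using assms
proof (induction i arbitrary: m)
  case 0
  then obtain k where "D = m * k" by fastforce
  then show ?case using 0 by simp
next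
  case (Suc i)
  define c where "c = real (m + i choose m)"
  have c: "c > 0" unfolding c_def by simp
  have m: "real m > 0" using Suc.prems by simp
  \<comment> \<open>Both neighbouring binomial coefficients are expressed through \<open>c\<close>,
    so the recurrence becomes an identity of fractions.\<close>
  have "Suc m * (Suc (m + i) choose Suc m) = Suc (m + i) * (m + i choose m)"
    by (rule Suc_times_binomial)
  then have "real (Suc m) * real (Suc (m + i) choose Suc m) = real (Suc (m + i)) * c"
    unfolding c_def by (metis of_nat_mult)
  then have 1: "real (Suc m) * real (Suc m + i choose Suc m) = (real m + real i + 1) * c"
    by (simp del: binomial_Suc_Suc add: add_ac)
  have "Suc i * (Suc (m + i) choose Suc i) = Suc (m + i) * (m + i choose i)"
    by (rule Suc_times_binomial)
  moreover have "Suc (m + i) choose Suc i = m + Suc i choose m" "m + i choose i = m + i choose m"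
    using binomial_symmetric[of "Suc i" "Suc (m + i)"] binomial_symmetric[of i "m + i"] by simp_all
  ultimately have "real (Suc i) * real (m + Suc i choose m) = real (Suc (m + i)) * c"
    unfolding c_def by (metis of_nat_mult)
  then have 2: "(real i + 1) * real (m + Suc i choose m) = (real m + real i + 1) * c"
    by (simp del: binomial_Suc_Suc add: add_ac)
  then have 3: "real (m + Suc i choose m) = (real m + real i + 1) * c / (real i + 1)"
    by (simp add: field_simps)
  have "real D / (real m * real (m + Suc i choose m))
    = real D / (real m * c) - real D / (real (Suc m) * real (Suc m + i choose Suc m))"
    unfolding 1 3 using c m by (simp add: divide_simps) (simp add: algebra_simps)
  moreover have "real D / (real m * c) \<in> \<int>"
    unfolding c_def using Suc.prems by (intro Suc.IH) auto
  moreover have "real D / (real (Suc m) * real (Suc m + i choose Suc m)) \<in> \<int>"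
    using Suc.prems by (intro Suc.IH) auto
  ultimately show ?case by simp
qed

text \<open>The triangle makes \<open>D / (m * (2 m choose m))\<close> a positive integer, so
  \<open>D\<close> is at least this denominator.\<close>

lemma common_multiple_ge_power_two:
  fixes D m :: nat
  assumes "\<And>q. 1 \<le> q \<Longrightarrow> q \<le> 2 * m \<Longrightarrow> q dvd D" and "1 \<le> m" "D > 0"
  shows "2 ^ m \<le> D"
proof -
  define b where "b = real m * real (m + m choose m)"
  have b: "b > 0" unfolding b_def using assms by simp
  have "real D / b \<in> \<int>"
    unfolding b_def using assms by (intro leibniz_triangle_integral) (auto simp: mult_2)
  then obtain z where z: "real D / b = of_int z" by (elim Ints_cases)
  moreover have "real D / b > 0" using b assms by simp
  ultimately have "real D / b \<ge> 1" by simp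
  then have Db: "b \<le> real D" using b by simp
  have "(2::real) ^ m = (real (m + m) / real m) ^ m" using assms by simp
  also have "\<dots> \<le> real (m + m choose m)" by (rule binomial_ge_n_over_k_pow_k) simp
  also have "\<dots> \<le> b" unfolding b_def using assms by simp
  also note Db
  finally show ?thesis by (metis of_nat_le_iff of_nat_numeral of_nat_power)
qed

text \<open>A \<open>q\<close> not dividing the product \<open>D\<close> of all differences divides
  none of them. \<open>D\<close> has at most \<open>n^2\<close> factors, each at most
  \<open>2 ^ n^2\<close>, so it lies below \<open>2 ^ (n^4 + 1)\<close> and some \<open>q\<close> up
  to \<open>2 * (n^4 + 1)\<close> fails to divide it.\<close>

lemma factorials_distinct_mod:
  fixes n :: nat
  obtains q where "1 \<le> q" "q \<le> 2 * (n ^ 4 + 1)" "inj_on (\<lambda>a. fact a mod q :: nat) {1..n}"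
proof -
  \<comment> \<open>Starting at 1 excludes \<open>0! = 1!\<close>, and \<open>a < b\<close> keeps
    natural subtraction exact, so \<open>D\<close> is positive.\<close>
  define P where "P = {(a, b). 1 \<le> a \<and> a < b \<and> b \<le> n}"
  define D :: nat where "D = (\<Prod>(a, b)\<in>P. fact b - fact a)"
  have sub: "P \<subseteq> {1..n} \<times> {1..n}" unfolding P_def by auto
  then have fin: "finite P" by (rule finite_subset) simp
  have "card P \<le> card ({1..n} \<times> {1..n})" using sub by (intro card_mono) auto
  then have cP: "card P \<le> n\<^sup>2" by (simp add: power2_eq_square)
  have pos: "fact a < (fact b :: nat)" if "(a, b) \<in> P" for a b
    using that unfolding P_def by (auto intro: fact_less_mono)
  have D0: "D > 0" unfolding D_def using pos by (auto intro!: prod_pos)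
  have bound: "fact b - fact a \<le> (2::nat) ^ n\<^sup>2" if "(a, b) \<in> P" for a b
  proof -
    have "fact b - fact a \<le> (fact n :: nat)"
      using that unfolding P_def by (auto intro!: le_trans[OF diff_le_self] fact_mono)
    also have "\<dots> \<le> n ^ n" by (metis fact_le_power of_nat_id order_refl)
    also have "\<dots> \<le> (2 ^ n) ^ n" by (intro power_mono) (auto simp: less_imp_le)
    finally show ?thesis by (simp add: power_mult[symmetric] power2_eq_square)
  qed
  have "D \<le> (\<Prod>x\<in>P. 2 ^ n\<^sup>2)" unfolding D_def using bound by (intro prod_mono) auto
  also have "\<dots> = (2 ^ n\<^sup>2) ^ card P" by simp
  also have "\<dots> \<le> (2 ^ n\<^sup>2) ^ n\<^sup>2" using cP by (intro power_increasing) auto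
  also have "\<dots> = 2 ^ (n ^ 4)" by (simp add: power_mult[symmetric] power_add[symmetric])
  also have "\<dots> < 2 ^ (n ^ 4 + 1)" by simp
  finally have "\<not> 2 ^ (n ^ 4 + 1) \<le> D" by simp
  then obtain q where q: "1 \<le> q" "q \<le> 2 * (n ^ 4 + 1)" "\<not> q dvd D"
    using common_multiple_ge_power_two[of "n ^ 4 + 1" D] D0 by auto
  have ne: "fact a mod q \<noteq> (fact b mod q :: nat)" if "1 \<le> a" "a < b" "b \<le> n" for a b
  proof
    assume eq: "fact a mod q = (fact b mod q :: nat)"
    have ab: "(a, b) \<in> P" using that unfolding P_def by simp
    have "q dvd fact b - fact a" using eq pos[OF ab] by (metis mod_eq_dvd_iff_nat less_imp_le)
    moreover have "fact b - fact a dvd D"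
      unfolding D_def using dvd_prodI[OF fin ab, where f = "\<lambda>(a, b). fact b - fact a :: nat"] by simp
    ultimately show False using q(3) by (meson dvd_trans)
  qed
  have "inj_on (\<lambda>a. fact a mod q :: nat) {1..n}"
    by (rule linorder_inj_onI) (use ne in auto)
  then show ?thesis using q that by blast
qed

subsection \<open>Spheres modulo \<open>q\<close>\<close>

text \<open>This is the spherical average, at \<open>t\<close> and all its translates by multiples
  of \<open>q\<close>, of the indicator of the lattice of multiples of \<open>q\<close>.\<close>

definition residue_density :: "nat \<Rightarrow> nat \<Rightarrow> int ^ 'd::finite \<Rightarrow> real" where
  "residue_density q l t =
     real (card {n \<in> lattice_sphere l. \<forall>i. int q dvd n $ i - t $ i})
       / real (card (lattice_sphere l :: (int ^ 'd) set))"

definition residue_cell :: "nat \<Rightarrow> (int ^ 'd::finite) set" where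
  "residue_cell q = {t. \<forall>i. t $ i \<in> {0..<int q}}"

lemma vec_set_eq_image_PiE: "{v. \<forall>i. v $ i \<in> A} = vec_lambda ` (UNIV \<rightarrow>\<^sub>E A)"
proof (intro equalityI subsetI)
  fix v :: "'a ^ 'b" assume "v \<in> {v. \<forall>i. v $ i \<in> A}"
  then show "v \<in> vec_lambda ` (UNIV \<rightarrow>\<^sub>E A)"
    by (intro image_eqI[of _ _ "vec_nth v"]) (auto simp: PiE_UNIV_domain)
qed auto

lemma finite_vec_set: "finite A \<Longrightarrow> finite {v :: 'a ^ 'd::finite. \<forall>i. v $ i \<in> A}"
  unfolding vec_set_eq_image_PiE by (intro finite_imageI finite_PiE) auto

lemma card_vec_set: "card {v :: 'a ^ 'd::finite. \<forall>i. v $ i \<in> A} = card A ^ CARD('d)"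
proof -
  have "inj_on vec_lambda (UNIV \<rightarrow>\<^sub>E A :: ('d \<Rightarrow> 'a) set)"
    by (intro inj_onI) (simp add: vec_lambda_inject)
  then show ?thesis
    unfolding vec_set_eq_image_PiE by (simp add: card_image card_PiE)
qed

lemma finite_residue_cell: "finite (residue_cell q)"
  unfolding residue_cell_def by (intro finite_vec_set) simp

lemma card_residue_cell: "card (residue_cell q :: (int ^ 'd::finite) set) = q ^ CARD('d)"
  unfolding residue_cell_def card_vec_set by simp

lemma residue_density_le_1:
  fixes t :: "int ^ 'd::finite"
  shows "residue_density q l t \<le> 1"
proof -
  have "card {n \<in> lattice_sphere l. \<forall>i. int q dvd n $ i - t $ i} \<le> card (lattice_sphere l :: (int ^ 'd) set)"
    by (intro card_mono finite_lattice_sphere) auto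
  then show ?thesis unfolding residue_density_def by (simp add: divide_le_eq_1) arith
qed

lemma sum_residue_density:
  assumes q: "q > 0" and ne: "lattice_sphere l \<noteq> ({} :: (int ^ 'd::finite) set)"
  shows "(\<Sum>t\<in>residue_cell q. residue_density q l (t :: int ^ 'd)) = 1"
proof -
  let ?S = "lattice_sphere l :: (int ^ 'd) set"
  define red :: "int ^ 'd \<Rightarrow> int ^ 'd" where "red n = (\<chi> i. n $ i mod int q)" for n
  have "red ` ?S \<subseteq> residue_cell q"
    using q unfolding red_def residue_cell_def by auto
  then have "(\<Sum>t\<in>residue_cell q. sum (\<lambda>_. 1) {n \<in> ?S. red n = t}) = sum (\<lambda>_. 1 :: nat) ?S"
    by (intro sum.group finite_lattice_sphere finite_residue_cell)
  then have *: "(\<Sum>t\<in>residue_cell q. card {n \<in> ?S. red n = t}) = card ?S" by simp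
  have "{n \<in> ?S. red n = t} = {n \<in> ?S. \<forall>i. int q dvd n $ i - t $ i}" if "t \<in> residue_cell q" for t
  proof -
    have "t $ i = t $ i mod int q" for i using that unfolding residue_cell_def by simp
    then have "red n = t \<longleftrightarrow> (\<forall>i. int q dvd n $ i - t $ i)" for n
      unfolding red_def vec_eq_iff mod_eq_dvd_iff[symmetric] by simp
    then show ?thesis by simp
  qed
  then have "(\<Sum>t\<in>residue_cell q. residue_density q l (t :: int ^ 'd))
    = (\<Sum>t\<in>residue_cell q. real (card {n \<in> ?S. red n = t}) / real (card ?S))"
    unfolding residue_density_def by (intro sum.cong) auto
  also have "\<dots> = real (\<Sum>t\<in>residue_cell q. card {n \<in> ?S. red n = t}) / real (card ?S)"
    by (simp add: sum_divide_distrib)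
  also have "\<dots> = 1" unfolding * using ne by (simp add: finite_lattice_sphere)
  finally show ?thesis .
qed

text \<open>A sphere point \<open>n\<close> congruent to \<open>t\<close> has \<open>|n|^2\<close>
  congruent to \<open>|t|^2\<close>. Squared radii distinct modulo \<open>q\<close> thus have
  densities with disjoint supports.\<close>

lemma residue_density_pos_imp:
  assumes "residue_density q l t > 0"
  shows "(\<Sum>i\<in>UNIV. (t $ i)\<^sup>2) mod int q = int (l mod q)"
proof -
  have "{n \<in> lattice_sphere l. \<forall>i. int q dvd n $ i - t $ i} \<noteq> {}"
    using assms unfolding residue_density_def by (metis card.empty div_0 less_irrefl of_nat_0)
  then obtain n where n: "n \<in> lattice_sphere l" "\<And>i. int q dvd n $ i - t $ i" by blast
  have "int q dvd (n $ i)\<^sup>2 - (t $ i)\<^sup>2" for i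
  proof -
    have "(n $ i)\<^sup>2 - (t $ i)\<^sup>2 = (n $ i - t $ i) * (n $ i + t $ i)" by algebra
    then show ?thesis using n(2) by simp
  qed
  then have "int q dvd (\<Sum>i\<in>UNIV. (n $ i)\<^sup>2 - (t $ i)\<^sup>2)" by (intro dvd_sum) auto
  then have "int q dvd int l - (\<Sum>i\<in>UNIV. (t $ i)\<^sup>2)"
    using n(1) by (simp add: sum_subtractf mem_lattice_sphere_iff)
  then show ?thesis by (metis mod_eq_dvd_iff zmod_int)
qed

section \<open>Dyadic levels of the residue densities\<close>

text \<open>At the first \<open>j\<close> with \<open>p > 1 / 2 ^ j\<close>, \<open>p\<close> is at
  most twice this threshold; \<open>p \<le> 1\<close> rules out \<open>j = 0\<close>.\<close>

lemma dyadic_layer_bound: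
  fixes p :: real
  assumes "p \<le> 1"
  shows "p \<le> 1 / 2 ^ J + (\<Sum>j\<in>{1..J}. if p > 1 / 2 ^ j then 2 / 2 ^ j else 0)"
proof (cases "p \<le> 1 / 2 ^ J")
  case True
  moreover have "0 \<le> (\<Sum>j\<in>{1..J}. if p > 1 / 2 ^ j then 2 / 2 ^ j else (0::real))"
    by (intro sum_nonneg) auto
  ultimately show ?thesis by linarith
next
  case False
  define j where "j = (LEAST j. p > 1 / 2 ^ j)"
  have J: "p > 1 / 2 ^ J" using False by simp
  have j: "p > 1 / 2 ^ j" unfolding j_def using J by (rule LeastI)
  have jJ: "j \<le> J" unfolding j_def using J by (rule Least_le)
  have "j \<noteq> 0" using j assms by (intro notI) simp
  then obtain i where i: "j = Suc i" by (cases j) auto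
  have "\<not> p > 1 / 2 ^ i" using not_less_Least[of i "\<lambda>j. p > 1 / 2 ^ j"] i unfolding j_def by simp
  then have "p \<le> 2 / 2 ^ j" unfolding i by simp
  also have "\<dots> = (if p > 1 / 2 ^ j then 2 / 2 ^ j else 0)" using j by simp
  also have "\<dots> \<le> (\<Sum>j\<in>{1..J}. if p > 1 / 2 ^ j then 2 / 2 ^ j else 0)"
    using jJ i by (intro member_le_sum[of j "{1..J}" "\<lambda>j. if p > 1 / 2 ^ j then 2 / 2 ^ j else 0"]) auto
  finally show ?thesis by (smt (verit) divide_nonneg_nonneg zero_le_power)
qed

lemma lattice_sphere_coord_bound:
  assumes "n \<in> lattice_sphere l" shows "\<bar>n $ i\<bar> \<le> int l"
proof -
  have "(n $ i)\<^sup>2 \<le> (\<Sum>i\<in>UNIV. (n $ i)\<^sup>2)" by (rule member_le_sum) auto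
  then have "(n $ i)\<^sup>2 \<le> int l" using assms by (simp add: mem_lattice_sphere_iff)
  moreover have "\<bar>n $ i\<bar> \<le> (n $ i)\<^sup>2"
    using self_le_power[of "\<bar>n $ i\<bar>" 2] by (cases "n $ i = 0") auto
  ultimately show ?thesis by simp
qed

text \<open>The lattice \<open>q \<int>\<^sup>d\<close> is cut off to a box twice as large as the one containing the points
  at which the averages are evaluated; this costs only the factor \<open>2\<^sup>d\<close>.\<close>

lemma residue_density_level_bound:
  fixes lam :: "nat \<Rightarrow> nat"
  assumes weak: "weak_LlogL_bound TYPE('d::finite) lam C0"
    and S: "finite S" "S \<subseteq> {1..}" and q: "q > 0"
  shows "real (card {t :: int ^ 'd. t \<in> residue_cell q \<and> (\<exists>k\<in>S. residue_density q (lam k) t > 1 / 2 ^ j)})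
    \<le> max C0 0 * 2 ^ CARD('d) * 2 ^ j * (1 + real j)"
proof -
  let ?E = "{t :: int ^ 'd. t \<in> residue_cell q \<and> (\<exists>k\<in>S. residue_density q (lam k) t > 1 / 2 ^ j)}"
  \<comment> \<open>Exceeds every squared radius in use; inserting 0 covers empty
    \<open>S\<close>.\<close>
  define M where "M = int (Max (insert 0 (lam ` S))) + 1"
  have M: "int (lam k) + 1 \<le> M" if "k \<in> S" for k
    unfolding M_def using that S by (simp add: Max_ge)
  have M1: "M \<ge> 1" unfolding M_def by simp
  define box :: "int \<Rightarrow> (int ^ 'd) set" where "box m = {y. \<forall>i. y $ i \<in> {- m..m}}" for m
  have cbox: "card (box m) = nat (2 * m + 1) ^ CARD('d)" and fbox: "finite (box m)" for m
    unfolding box_def card_vec_set by (simp_all add: finite_vec_set del: atLeastAtMost_iff)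
  define F where "F = (\<lambda>y. int q *s y) ` box (2 * M)"
  have F: "finite F" unfolding F_def by (intro finite_imageI fbox)
  have "card F \<le> card (box (2 * M))" unfolding F_def by (intro card_image_le fbox)
  then have cF: "card F \<le> nat (4 * M + 1) ^ CARD('d)" unfolding cbox by simp
  define f :: "int ^ 'd \<Rightarrow> complex" where "f x = (if x \<in> F then 1 else 0)" for x
  define a :: real where "a = 1 / 2 ^ j"
  have a: "a > 0" unfolding a_def by simp
  let ?L = "{x. maximal_op lam f x > ereal a}"
  have supp: "finite {x. f x \<noteq> 0}" using F by (simp add: f_def)
  have L: "finite ?L" "real (card ?L) \<le> C0 * (\<Sum>\<^sub>\<infinity>x. cmod (f x) / a * LL (cmod (f x) / a))"
    using weak a supp unfolding weak_LlogL_bound_def by blast+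
  have "(\<Sum>\<^sub>\<infinity>x. cmod (f x) / a * LL (cmod (f x) / a)) = (\<Sum>\<^sub>\<infinity>x\<in>F. 2 ^ j * LL (2 ^ j))"
    by (intro infsum_cong_neutral) (auto simp: f_def a_def)
  also have "\<dots> = real (card F) * (2 ^ j * LL (2 ^ j))" using F by simp
  also have "LL (2 ^ j) = 1 + real j * ln 2"
    unfolding LL_def log_plus_def by (simp add: ln_realpow)
  finally have inf: "(\<Sum>\<^sub>\<infinity>x. cmod (f x) / a * LL (cmod (f x) / a)) = real (card F) * (2 ^ j * (1 + real j * ln 2))" .
  have "ln (2::real) \<le> 1" using ln_le_minus_one[of "2::real"] by simp
  then have ln: "real j * ln 2 \<le> real j" by (simp add: mult_left_le)
  have "real (card ?L) \<le> C0 * (real (card F) * (2 ^ j * (1 + real j * ln 2)))"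
    using L(2) unfolding inf .
  \<comment> \<open>\<open>C0\<close> may be negative; its positive part keeps the bound
    monotone.\<close>
  also have "\<dots> \<le> max C0 0 * (real (nat (4 * M + 1) ^ CARD('d)) * (2 ^ j * (1 + real j)))"
    using cF ln by (intro mult_mono) (auto simp: of_nat_le_iff simp del: of_nat_power)
  finally have up: "real (card ?L) \<le> max C0 0 * (real (nat (4 * M + 1) ^ CARD('d)) * (2 ^ j * (1 + real j)))" .
  \<comment> \<open>Each class in \<open>?E\<close> recurs at \<open>(2 M + 1)^d\<close> points of
    the level set; division with remainder by \<open>q\<close> recovers \<open>t\<close> and
    \<open>y\<close>.\<close>
  define T where "T = (\<lambda>(t, y). t + int q *s y :: int ^ 'd)"
  have div: "t $ i = (t + int q *s y) $ i mod int q" "y $ i = (t + int q *s y) $ i div int q"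
    if "t \<in> residue_cell q" for t y :: "int ^ 'd" and i
    using that q by (simp_all add: residue_cell_def)
  have "inj_on T (?E \<times> box M)"
  proof (intro inj_onI)
    fix u u' :: "(int ^ 'd) \<times> (int ^ 'd)"
    assume u: "u \<in> ?E \<times> box M" "u' \<in> ?E \<times> box M" "T u = T u'"
    obtain t y where u1: "u = (t, y)" by (cases u)
    obtain t' y' where u2: "u' = (t', y')" by (cases u')
    have t: "t \<in> residue_cell q" and t': "t' \<in> residue_cell q"
      using u(1,2) by (simp_all only: u1 u2 mem_Sigma_iff mem_Collect_eq)
    have e: "t + int q *s y = t' + int q *s y'"
      using u(3) unfolding T_def by (simp only: u1 u2 prod.case)
    have "t $ i = t' $ i" "y $ i = y' $ i" for i
      using div[OF t, where y = y and i = i] div[OF t', where y = y' and i = i] unfolding e by (simp_all only:)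
    then have "t = t'" "y = y'" unfolding vec_eq_iff by blast+
    then show "u = u'" unfolding u1 u2 by simp
  qed
  moreover have "T ` (?E \<times> box M) \<subseteq> ?L"
  proof
    fix x assume "x \<in> T ` (?E \<times> box M)"
    then obtain u where u: "x = T u" "u \<in> ?E \<times> box M" by (rule imageE)
    obtain t y where ty: "u = (t, y)" by (cases u)
    have x: "x = t + int q *s y" using u(1) unfolding T_def by (simp only: ty prod.case)
    have t: "t \<in> residue_cell q" and y: "y \<in> box M"
      and "\<exists>k\<in>S. 1 / 2 ^ j < residue_density q (lam k) t"
      using u(2) by (simp_all only: ty mem_Sigma_iff mem_Collect_eq)
    then obtain k where k: "k \<in> S" and d: "1 / 2 ^ j < residue_density q (lam k) t" by blast
    let ?S = "lattice_sphere (lam k) :: (int ^ 'd) set"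
    have comp: "(t + int q *s y - n) $ i = t $ i + int q * y $ i - n $ i" for n i
      by (simp only: vector_add_component vector_minus_component vector_smult_component)
    \<comment> \<open>Apart from congruence, the truncation requires the quotient \<open>z\<close>
      to stay in \<open>box (2 * M)\<close>.\<close>
    have mem: "t + int q *s y - n \<in> F \<longleftrightarrow> (\<forall>i. int q dvd n $ i - t $ i)" if n: "n \<in> ?S" for n
    proof
      assume "t + int q *s y - n \<in> F"
      then obtain z where "t + int q *s y - n = int q *s z" unfolding F_def by blast
      then have "(t + int q *s y - n) $ i = (int q *s z) $ i" for i by (rule arg_cong)
      then have "t $ i + int q * y $ i - n $ i = int q * z $ i" for i
        unfolding comp vector_smult_component .
      then have "n $ i - t $ i = int q * (y $ i - z $ i)" for i
        unfolding right_diff_distrib by (smt (verit))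
      then show "\<forall>i. int q dvd n $ i - t $ i" by (simp only: dvd_triv_left simp_thms)
    next
      assume dvd: "\<forall>i. int q dvd n $ i - t $ i"
      define w where "w i = (n $ i - t $ i) div int q" for i
      have w: "n $ i - t $ i = int q * w i" for i
        unfolding w_def using dvd by (simp only: dvd_mult_div_cancel simp_thms)
      define z :: "int ^ 'd" where "z = (\<chi> i. y $ i - w i)"
      have "z $ i \<in> {- (2 * M)..2 * M}" for i
      proof -
        have "0 \<le> t $ i" "t $ i < int q" using t by (auto simp: residue_cell_def)
        moreover have "\<bar>n $ i\<bar> \<le> M - 1"
          using lattice_sphere_coord_bound[OF n, of i] M[OF k] by linarith
        \<comment> \<open>From \<open>|q w| < M + q \<le> q (M + 1)\<close> follows
          \<open>|w| \<le> M\<close> whatever \<open>q\<close> is; adding \<open>|y| \<le> M\<close>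
          explains the size \<open>2 * M\<close>.\<close>
        ultimately have "\<bar>int q * w i\<bar> < M - 1 + int q + 1" unfolding w[symmetric] by linarith
        also have "\<dots> \<le> int q * (M + 1)"
          using q M1 mult_right_mono[of 1 "int q" M] by (simp add: algebra_simps)
        finally have "int q * \<bar>w i\<bar> < int q * (M + 1)" by (simp add: abs_mult)
        then have "\<bar>w i\<bar> < M + 1" using q by simp
        moreover have "\<bar>y $ i\<bar> \<le> M" using y unfolding box_def by (auto simp: abs_le_iff minus_le_iff)
        ultimately show ?thesis unfolding z_def by auto
      qed
      then have "z \<in> box (2 * M)" unfolding box_def by simp
      moreover have "t + int q *s y - n = int q *s z"
        unfolding vec_eq_iff comp vector_smult_component z_def vec_lambda_beta right_diff_distrib w[symmetric]
        by simp
      ultimately show "t + int q *s y - n \<in> F" unfolding F_def by blast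
    qed
    have "(\<Sum>n\<in>?S. f (t + int q *s y - n)) = (\<Sum>n\<in>?S. if \<forall>i. int q dvd n $ i - t $ i then 1 else 0)"
      unfolding f_def using mem by (intro sum.cong) auto
    also have "\<dots> = of_nat (card {n \<in> ?S. \<forall>i. int q dvd n $ i - t $ i})"
      by (simp add: sum.If_cases finite_lattice_sphere Int_def)
    finally have "cmod (spherical_avg (lam k) f (t + int q *s y)) = residue_density q (lam k) t"
      unfolding spherical_avg_def residue_density_def by (simp add: norm_mult norm_divide)
    then have "ereal a < ereal (cmod (spherical_avg (lam k) f (t + int q *s y)))"
      using d unfolding a_def by simp
    also have "\<dots> \<le> maximal_op lam f (t + int q *s y)"
      unfolding maximal_op_def using k S(2) by (intro SUP_upper) auto
    finally show "x \<in> ?L" unfolding x by simp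
  qed
  ultimately have "card (?E \<times> box M) \<le> card ?L" using L(1) by (rule card_inj_on_le)
  then have "card ?E * nat (2 * M + 1) ^ CARD('d) \<le> card ?L"
    unfolding card_cartesian_product cbox .
  then have lower: "real (card ?E * nat (2 * M + 1) ^ CARD('d)) \<le> real (card ?L)"
    by (simp only: of_nat_le_iff)
  \<comment> \<open>By \<open>4 M + 1 \<le> 2 (2 M + 1)\<close> the box volumes cancel up to
    \<open>2^d\<close>, and no dependence on the radii survives.\<close>
  have box_ratio: "real (nat (4 * M + 1) ^ CARD('d)) \<le> real (2 ^ CARD('d) * nat (2 * M + 1) ^ CARD('d))"
    unfolding of_nat_le_iff power_mult_distrib[symmetric] using M1 by (intro power_mono) auto
  have "max C0 0 * (real (nat (4 * M + 1) ^ CARD('d)) * (2 ^ j * (1 + real j)))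
    \<le> max C0 0 * (real (2 ^ CARD('d) * nat (2 * M + 1) ^ CARD('d)) * (2 ^ j * (1 + real j)))"
    by (intro mult_left_mono mult_right_mono box_ratio) auto
  with lower up have "real (card ?E * nat (2 * M + 1) ^ CARD('d))
    \<le> max C0 0 * (real (2 ^ CARD('d) * nat (2 * M + 1) ^ CARD('d)) * (2 ^ j * (1 + real j)))"
    by linarith
  then have "real (card ?E) * real (nat (2 * M + 1) ^ CARD('d))
    \<le> (max C0 0 * 2 ^ CARD('d) * 2 ^ j * (1 + real j)) * real (nat (2 * M + 1) ^ CARD('d))"
    by (simp add: ac_simps)
  moreover have "real (nat (2 * M + 1) ^ CARD('d)) > 0" using M1 by simp
  ultimately show ?thesis by (rule mult_right_le_imp_le)
qed

text \<open>No equidistribution modulo \<open>q\<close> is needed: whatever the scale at which a residue density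
  concentrates, that scale is one of \<open>J\<close> dyadic ones, and at each of them the supports of
  different densities are disjoint.\<close>

lemma card_bound_if_distinct_residues:
  fixes lam :: "nat \<Rightarrow> nat"
  assumes weak: "weak_LlogL_bound TYPE('d::finite) lam C0"
    and S: "finite S" "S \<subseteq> {1..}" and q: "q > 0"
    and inj: "inj_on (\<lambda>k. lam k mod q) S"
    and ne: "\<And>k. k \<in> S \<Longrightarrow> lattice_sphere (lam k) \<noteq> ({} :: (int ^ 'd) set)"
    and J: "2 * q ^ CARD('d) \<le> 2 ^ J"
  shows "real (card S) \<le> 4 * (max C0 0 * 2 ^ CARD('d)) * (real J + 1)\<^sup>2"
proof -
  define B where "B = max C0 0 * 2 ^ CARD('d)"
  have B: "B \<ge> 0" unfolding B_def by simp
  define E :: "nat \<Rightarrow> nat \<Rightarrow> (int ^ 'd) set" where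
    "E j k = {t \<in> residue_cell q. residue_density q (lam k) t > 1 / 2 ^ j}" for j k
  have fE: "finite (E j k)" for j k unfolding E_def by (simp add: finite_residue_cell)
  \<comment> \<open>Residues of density at most \<open>1 / 2 ^ J\<close> carry mass at most 1/2; the
    dyadic layers account for the other half.\<close>
  have "real (2 * q ^ CARD('d)) \<le> real (2 ^ J)" using J by (simp only: of_nat_le_iff)
  then have J': "real (q ^ CARD('d)) / 2 ^ J \<le> 1 / 2" by (simp add: field_simps)
  have one: "1 / 2 \<le> (\<Sum>j\<in>{1..J}. 2 / 2 ^ j * real (card (E j k)))" if k: "k \<in> S" for k
  proof -
    let ?p = "residue_density q (lam k) :: int ^ 'd \<Rightarrow> real"
    have "1 = (\<Sum>t\<in>residue_cell q. ?p t)" using sum_residue_density[OF q ne[OF k]] by simp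
    also have "\<dots> \<le> (\<Sum>t\<in>residue_cell q. 1 / 2 ^ J + (\<Sum>j\<in>{1..J}. if ?p t > 1 / 2 ^ j then 2 / 2 ^ j else 0))"
      by (intro sum_mono dyadic_layer_bound residue_density_le_1)
    also have "\<dots> = real (q ^ CARD('d)) / 2 ^ J
      + (\<Sum>j\<in>{1..J}. \<Sum>t\<in>residue_cell q. if ?p t > 1 / 2 ^ j then 2 / 2 ^ j else 0)"
      unfolding sum.distrib by (subst (2) sum.swap) (simp add: card_residue_cell)
    also have "(\<Sum>j\<in>{1..J}. \<Sum>t\<in>residue_cell q. if ?p t > 1 / 2 ^ j then 2 / 2 ^ j else 0)
      = (\<Sum>j\<in>{1..J}. 2 / 2 ^ j * real (card (E j k)))"
      unfolding E_def by (intro sum.cong) (auto simp: sum.If_cases finite_residue_cell Int_def)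
    finally show ?thesis using J' by linarith
  qed
  have disj: "E j k \<inter> E j k' = {}" if "k \<in> S" "k' \<in> S" "k \<noteq> k'" for j k k'
  proof (rule ccontr)
    assume "E j k \<inter> E j k' \<noteq> {}"
    then obtain t :: "int ^ 'd" where "residue_density q (lam k) t > 1 / 2 ^ j" "residue_density q (lam k') t > 1 / 2 ^ j"
      unfolding E_def by blast
    moreover have "(0::real) < 1 / 2 ^ j" by simp
    ultimately have "residue_density q (lam k) t > 0" "residue_density q (lam k') t > 0"
      by (meson less_trans)+
    then have "int (lam k mod q) = int (lam k' mod q)" using residue_density_pos_imp by metis
    then show False using that inj by (auto simp: inj_on_def simp del: zmod_int)
  qed
  \<comment> \<open>By disjointness the sum over \<open>k\<close> counts a single set, so the
    weak-type bound is used once, whatever the size of \<open>S\<close>.\<close>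
  have level: "(\<Sum>k\<in>S. real (card (E j k))) \<le> B * 2 ^ j * (1 + real j)" for j
  proof -
    have "(\<Sum>k\<in>S. card (E j k)) = card (\<Union>k\<in>S. E j k)"
      using S fE disj by (intro card_UN_disjoint[symmetric]) auto
    also have "(\<Union>k\<in>S. E j k)
      = {t. t \<in> residue_cell q \<and> (\<exists>k\<in>S. residue_density q (lam k) t > 1 / 2 ^ j)}"
      unfolding E_def by blast
    finally have "(\<Sum>k\<in>S. real (card (E j k))) = real (card {t :: int ^ 'd.
        t \<in> residue_cell q \<and> (\<exists>k\<in>S. residue_density q (lam k) t > 1 / 2 ^ j)})"
      by (metis of_nat_sum)
    then show ?thesis using residue_density_level_bound[OF weak S q, of j] unfolding B_def by simp
  qed
  \<comment> \<open>Double counting: each sphere contributes at least 1/2, and layer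
    \<open>j\<close> at most \<open>2 B (1 + j)\<close>, since the weight \<open>2 / 2 ^ j\<close>
    cancels the growth \<open>2 ^ j\<close>.\<close>
  have "real (card S) / 2 = (\<Sum>k\<in>S. 1 / 2)" by simp
  also have "\<dots> \<le> (\<Sum>k\<in>S. \<Sum>j\<in>{1..J}. 2 / 2 ^ j * real (card (E j k)))"
    by (intro sum_mono one)
  also have "\<dots> = (\<Sum>j\<in>{1..J}. 2 / 2 ^ j * (\<Sum>k\<in>S. real (card (E j k))))"
    by (subst sum.swap) (simp add: sum_distrib_left)
  also have "\<dots> \<le> (\<Sum>j\<in>{1..J}. 2 * B * (1 + real J))"
  proof (rule sum_mono)
    fix j assume j: "j \<in> {1..J}"
    have "2 / 2 ^ j * (\<Sum>k\<in>S. real (card (E j k))) \<le> 2 / 2 ^ j * (B * 2 ^ j * (1 + real j))"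
      by (intro mult_left_mono level) simp
    also have "\<dots> = 2 * B * (1 + real j)" by simp
    also have "\<dots> \<le> 2 * B * (1 + real J)" using j B by (intro mult_left_mono) auto
    finally show "2 / 2 ^ j * (\<Sum>k\<in>S. real (card (E j k))) \<le> 2 * B * (1 + real J)" .
  qed
  also have "\<dots> = real J * (2 * B * (1 + real J))" by simp
  also have "\<dots> \<le> (real J + 1) * (2 * B * (1 + real J))" using B by (intro mult_right_mono) auto
  finally show ?thesis unfolding B_def[symmetric] by (simp add: power2_eq_square algebra_simps)
qed

section \<open>Choice of parameters and the counting bound\<close>

theorem propositionA:
  fixes C0 :: real
  assumes "CARD('d::finite) \<ge> 5"
  shows "\<exists>C::real. \<forall>\<mu> :: nat \<Rightarrow> nat.
           strict_mono_on {1..} \<mu> \<longrightarrow> (\<forall>k\<ge>1. \<mu> k > 0) \<longrightarrow>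
           weak_LlogL_bound TYPE('d) (\<lambda>k. fact (\<mu> k)) C0 \<longrightarrow>
           (\<forall>N\<ge>2. real (counting \<mu> N) \<le> C * (1 + ln N)\<^sup>2)"
proof (intro exI allI impI)
  let ?d = "CARD('d)"
  fix \<mu> :: "nat \<Rightarrow> nat" and N :: real
  assume mono: "strict_mono_on {1..} \<mu>" and pos: "\<forall>k\<ge>1. \<mu> k > 0"
    and weak: "weak_LlogL_bound TYPE('d) (\<lambda>k. fact (\<mu> k)) C0" and N: "2 \<le> N"
  define n where "n = nat \<lfloor>N\<rfloor>"
  have le_n: "m \<le> n \<longleftrightarrow> real m \<le> N" for m
    unfolding n_def using N by (simp add: le_nat_iff le_floor_iff)
  have n: "n \<ge> 1" "real n \<le> N" using le_n[of 1] le_n[of n] N by auto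
  define S where "S = {k. k \<ge> 1 \<and> real (\<mu> k) \<le> N}"
  have S1: "S \<subseteq> {1..}" unfolding S_def by auto
  have inj: "inj_on \<mu> S"
    using strict_mono_on_imp_inj_on[OF mono] S1 by (rule inj_on_subset)
  have im: "\<mu> ` S \<subseteq> {1..n}"
    unfolding S_def using pos le_n by (auto simp: Suc_le_eq)
  then have fin: "finite S" using inj by (metis finite_atLeastAtMost finite_imageD finite_subset)
  obtain q where q: "1 \<le> q" "q \<le> 2 * (n ^ 4 + 1)" "inj_on (\<lambda>a. fact a mod q :: nat) {1..n}"
    using factorials_distinct_mod by blast
  have inj': "inj_on (\<lambda>k. fact (\<mu> k) mod q :: nat) S"
    using comp_inj_on[OF inj inj_on_subset[OF q(3) im]] by (simp add: comp_def)
  define e where "e = nat \<lceil>log 2 N\<rceil>"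
  have e: "log 2 N \<le> real e" "real e \<le> log 2 N + 1"
    unfolding e_def using N by auto
  have "N = 2 powr log 2 N" using N by simp
  also have "\<dots> \<le> 2 powr real e" using e by (intro powr_mono) auto
  also have "\<dots> = real (2 ^ e)" by (simp add: powr_realpow)
  finally have "real n \<le> real (2 ^ e)" using n(2) by (rule order_trans[rotated])
  then have ne: "n \<le> 2 ^ e" by (rule of_nat_le_iff[THEN iffD1])
  \<comment> \<open>\<open>n \<ge> 1\<close> gives \<open>2 (n^4 + 1) \<le> 4 n^4\<close>, and
    \<open>n \<le> 2 ^ e\<close> turns this into the exponent \<open>4 e + 2\<close>.\<close>
  have "q \<le> 4 * n ^ 4" using q(2) one_le_power[OF n(1), of 4] by simp
  also have "\<dots> \<le> 4 * (2 ^ e) ^ 4" using ne by (intro mult_left_mono power_mono) auto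
  also have "\<dots> = 2 ^ (4 * e + 2)" by (simp add: power_mult[symmetric] power_add mult.commute)
  finally have "q \<le> 2 ^ (4 * e + 2)" .
  then have "q ^ ?d \<le> (2 ^ (4 * e + 2)) ^ ?d" by (rule power_mono) simp
  then have qd: "q ^ ?d \<le> 2 ^ ((4 * e + 2) * ?d)" by (simp only: power_mult)
  \<comment> \<open>The final \<open>+ 1\<close> supplies the factor 2 in
    \<open>2 * q ^ d \<le> 2 ^ J\<close>.\<close>
  define J where "J = (4 * e + 2) * ?d + 1"
  have J: "2 * q ^ ?d \<le> 2 ^ J"
    using mult_le_mono2[OF qd, of 2] unfolding J_def by (simp only: power_add power_one_right mult.commute)
  have "real (card S) \<le> 4 * (max C0 0 * 2 ^ ?d) * (real J + 1)\<^sup>2"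
    using q(1) assms
    by (intro card_bound_if_distinct_residues[OF weak fin S1 _ inj' _ J] lattice_sphere_nonempty) auto
  also have "(real J + 1)\<^sup>2 \<le> (8 * real ?d * (1 + ln N))\<^sup>2"
  proof (rule power_mono)
    \<comment> \<open>This passes from binary to natural logarithms at the cost of a factor 2; with
      \<open>J + 1 \<le> 4 d (e + 1)\<close> it yields \<open>8 d\<close>.\<close>
    have "ln (2::real) \<ge> 1 / 2" using ln_le_minus_one[of "1 / 2 :: real"] by (simp add: ln_div)
    moreover have "ln N \<ge> 0" using N by simp
    ultimately have "ln N * 1 \<le> ln N * (2 * ln 2)" by (intro mult_left_mono) auto
    then have "log 2 N \<le> 2 * ln N" unfolding log_def by (simp add: divide_le_eq ac_simps)
    then have "real e + 1 \<le> 2 * (1 + ln N)" using e by simp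
    moreover have "real J + 1 \<le> 4 * real ?d * (real e + 1)"
      unfolding J_def using assms by (simp add: algebra_simps)
    ultimately show "real J + 1 \<le> 8 * real ?d * (1 + ln N)"
      using mult_left_mono[of "real e + 1" "2 * (1 + ln N)" "4 * real ?d"] by (simp add: algebra_simps)
  qed simp
  finally have "real (card S) \<le> 4 * (max C0 0 * 2 ^ ?d) * (8 * real ?d * (1 + ln N))\<^sup>2"
    by (simp add: mult_left_mono)
  \<comment> \<open>The existential witness, left open until here, is fixed; it involves only
    \<open>d\<close> and \<open>C0\<close>.\<close>
  then show "real (counting \<mu> N) \<le> (4 * (max C0 0 * 2 ^ ?d) * (8 * real ?d)\<^sup>2) * (1 + ln N)\<^sup>2"
    unfolding counting_def S_def by (simp only: power_mult_distrib mult.assoc)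
qed

end
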